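(* Let $R$ be a finite local commutative ring, $K\le R^\times$ a pure group, $\mathcal C=\mathrm{Cyc}(K,R)$, $I_0=\{x\in\mathrm{rad}(R): x\,\mathrm{rad}(R)=\{0\}\}$ and $E_0$ the equivalence relation on $R$ whose classes are the cosets of $I_0$. Then the natural mapping $\mathrm{Aut}_{\mathcal C}(R)\to\mathrm{Aut}_{\mathcal C}(R/I_0)$ is a monomorphism. Moreover, $\mathrm{Aut}(\mathcal C)\le\mathrm{A\Gamma L}_1(R)$ whenever $\mathrm{Aut}(\mathcal C)^{R/E_0}\le\mathrm{A\Gamma L}_1(R/I_0)$.
   Context: All rings have an identity; $\mathrm{rad}(R)$ is the maximal ideal of the local ring $R$. $\mathrm{Cyc}(K,R)$ is the pair $(R,\mathrm{Rel}(K,R))$ with $\mathrm{Rel}(K,R)$ the relations $\{(x,y): y-x\in rK\}$, $r\in R$; $\mathrm{Aut}(\mathcal C)$ is the group of permutations of $R$ fixing each such relation. $\mathrm{A\Gamma L}_1(S)$, for a ring $S$, is the group of permutations $x\mapsto ax^\sigma+b$, $a\in S^\times$, $b\in S$, $\sigma\in\mathrm{Aut}(S)$. A group $K$ is pure if the only ideal $I$ with $1+I\subseteq K$ is $\{0\}$. The equivalence $E_0$ is $\mathrm{Aut}(\mathcal C)$-invariant, and $\mathrm{Aut}(\mathcal C)^{R/E_0}$ denotes the group of permutations of $R/E_0=R/I_0$ induced by $\mathrm{Aut}(\mathcal C)$. $\mathrm{Aut}_{\mathcal C}(R)=\mathrm{Aut}(\mathcal C)\cap\mathrm{Aut}(R)$.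 The quotient scheme of $\mathcal C$ modulo $E_0$ is the cyclotomic scheme $\mathrm{Cyc}(\pi_0(K),R/I_0)$, $\pi_0:R\to R/I_0$ the natural epimorphism, and $\mathrm{Aut}_{\mathcal C}(R/I_0)=\mathrm{Aut}(\mathrm{Cyc}(\pi_0(K),R/I_0))\cap\mathrm{Aut}(R/I_0)$. The natural mapping sends $\sigma\in\mathrm{Aut}_{\mathcal C}(R)$ to the automorphism of $R/I_0$ it induces. *)

theory Defs
  imports Main
begin

definition is_ideal :: "'a::comm_ring_1 set \<Rightarrow> bool" where
  "is_ideal I \<longleftrightarrow> 0 \<in> I \<and> (\<forall>x\<in>I. \<forall>y\<in>I. x + y \<in> I) \<and> (\<forall>r. \<forall>x\<in>I. r * x \<in> I)"

definition is_maximal_ideal :: "'a::comm_ring_1 set \<Rightarrow> bool" where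
  "is_maximal_ideal M \<longleftrightarrow> is_ideal M \<and> M \<noteq> UNIV \<and>
     (\<forall>J. is_ideal J \<and> M \<subseteq> J \<longrightarrow> J = M \<or> J = UNIV)"

definition local_ring :: "'a::comm_ring_1 itself \<Rightarrow> bool" where
  "local_ring (_::'a itself) \<longleftrightarrow> (\<exists>!M::'a set. is_maximal_ideal M)"

definition rad :: "'a::comm_ring_1 set" where
  "rad = (THE M. is_maximal_ideal M)"

definition unit_subgroup :: "'a::comm_ring_1 set \<Rightarrow> bool" where
  "unit_subgroup K \<longleftrightarrow> (\<forall>k\<in>K. k dvd 1) \<and> 1 \<in> K \<and> (\<forall>x\<in>K. \<forall>y\<in>K. x * y \<in> K)
     \<and> (\<forall>x\<in>K. \<exists>y\<in>K. x * y = 1)"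

definition pure_group :: "'a::comm_ring_1 set \<Rightarrow> bool" where
  "pure_group K \<longleftrightarrow> (\<forall>I. is_ideal I \<and> (\<forall>i\<in>I. 1 + i \<in> K) \<longrightarrow> I = {0})"

definition I0 :: "'a::comm_ring_1 set" where
  "I0 = {x \<in> rad. \<forall>y\<in>rad. x * y = 0}"

text \<open>Automorphisms of Cyc(K,R): permutations fixing each relation Rel_r = {(x,y). y - x \<in> rK}.\<close>
definition cyc_aut :: "'a::comm_ring_1 set \<Rightarrow> ('a \<Rightarrow> 'a) \<Rightarrow> bool" where
  "cyc_aut K f \<longleftrightarrow> bij f \<and>
     (\<forall>r x y. (y - x \<in> (\<lambda>k. r * k) ` K) \<longleftrightarrow> (f y - f x \<in> (\<lambda>k. r * k) ` K))"

definition ring_aut :: "('a::comm_ring_1 \<Rightarrow> 'a) \<Rightarrow> bool" where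
  "ring_aut s \<longleftrightarrow> bij s \<and> (\<forall>x y. s (x + y) = s x + s y) \<and> (\<forall>x y. s (x * y) = s x * s y) \<and> s 1 = 1"

definition AGaL1 :: "('a::comm_ring_1 \<Rightarrow> 'a) \<Rightarrow> bool" where
  "AGaL1 f \<longleftrightarrow> (\<exists>a b s. a dvd 1 \<and> ring_aut s \<and> f = (\<lambda>x. a * s x + b))"

definition coset :: "'a::comm_ring_1 set \<Rightarrow> 'a \<Rightarrow> 'a set" where
  "coset I x = {y. y - x \<in> I}"

definition cosets :: "'a::comm_ring_1 set \<Rightarrow> 'a set set" where
  "cosets I = range (coset I)"

definition q_ring_aut :: "'a::comm_ring_1 set \<Rightarrow> ('a set \<Rightarrow> 'a set) \<Rightarrow> bool" where
  "q_ring_aut I s \<longleftrightarrow> bij_betw s (cosets I) (cosets I) \<and>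
     (\<forall>x y u v. s (coset I x) = coset I u \<and> s (coset I y) = coset I v \<longrightarrow>
        s (coset I (x + y)) = coset I (u + v) \<and> s (coset I (x * y)) = coset I (u * v)) \<and>
     s (coset I 1) = coset I 1"

text \<open>Automorphisms of Cyc(pi(K), R/I): the relation for coset r relates coset x, coset y
  iff coset y - coset x = coset r * coset k for some k in K.\<close>
definition q_cyc_aut :: "'a::comm_ring_1 set \<Rightarrow> 'a set \<Rightarrow> ('a set \<Rightarrow> 'a set) \<Rightarrow> bool" where
  "q_cyc_aut I K t \<longleftrightarrow> bij_betw t (cosets I) (cosets I) \<and>
     (\<forall>r x y u v. t (coset I x) = coset I u \<and> t (coset I y) = coset I v \<longrightarrow>
        ((\<exists>k\<in>K. coset I (y - x) = coset I (r * k)) \<longleftrightarrow> (\<exists>k\<in>K. coset I (v - u) = coset I (r * k))))"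

definition q_AGaL1 :: "'a::comm_ring_1 set \<Rightarrow> ('a set \<Rightarrow> 'a set) \<Rightarrow> bool" where
  "q_AGaL1 I t \<longleftrightarrow> (\<exists>a b s. (\<exists>c. coset I (a * c) = coset I 1) \<and> q_ring_aut I s \<and>
     (\<forall>x u. s (coset I x) = coset I u \<longrightarrow> t (coset I x) = coset I (a * u + b)))"

end

theory Submission
  imports "HOL-Algebra.Multiplicative_Group" "HOL-Algebra.QuotRing" Defs
begin

text \<open>
  Everything rests on one fact: an automorphism \<open>h\<close> of the scheme that acts trivially modulo
  \<open>I\<^sub>0\<close> and fixes \<open>0\<close> is \<open>x \<mapsto> x + a x\<close> with \<open>a \<in> I\<^sub>0\<close> and \<open>1 + a \<in> K\<close>. Let \<open>H\<close> be the additive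
  group of all such \<open>a\<close>; purity says that \<open>H\<close> contains no nonzero ideal. The displacement
  \<open>d = h - id\<close> satisfies \<open>d x - d y \<in> (x - y) H\<close> whenever \<open>x - y\<close> is a unit, and purity makes \<open>d\<close>
  constant on the cosets of the radical. By Lagrange interpolation \<open>d\<close> is a polynomial function,
  so by induction all differences \<open>d (x + b) - d x\<close> are affine, and purity then makes \<open>d - d 0\<close>
  additive. For additive displacements put \<open>T\<^sub>c d (x) = c\<^sup>-\<^sup>1 d (c x)\<close> and let \<open>t\<close> generate the units
  of the residue field. Additivity gives \<open>(1 + t)\<^sup>-\<^sup>1 (1 - T\<^sub>t) = T\<^bsub>1 + t\<^esub> - T\<^sub>t\<close>, so the image of
  \<open>1 - T\<^sub>t\<close> is stable under scalars; its values at \<open>1\<close> form an ideal inside \<open>H\<close>, hence vanish, and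
  \<open>d\<close> is linear.

  Injectivity follows by applying this to \<open>s\<^sub>1\<^sup>-\<^sup>1 s\<^sub>2\<close>. For the lifting statement normalise \<open>f 0 = 0\<close>,
  \<open>f 1 = 1\<close> and apply it to \<open>x \<mapsto> f\<^sup>-\<^sup>1 (f (x + z) - f z)\<close> and, for units \<open>z\<close>, to
  \<open>x \<mapsto> f\<^sup>-\<^sup>1 ((f z)\<^sup>-\<^sup>1 f (z x))\<close>.
\<close>

section \<open>Ideals, cosets and units\<close>

lemma is_ideal_zero: "is_ideal I \<Longrightarrow> 0 \<in> I"
  by (simp add: is_ideal_def)

lemma is_ideal_add: "is_ideal I \<Longrightarrow> x \<in> I \<Longrightarrow> y \<in> I \<Longrightarrow> x + y \<in> I"
  by (simp add: is_ideal_def)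

lemma is_ideal_mult: "is_ideal I \<Longrightarrow> x \<in> I \<Longrightarrow> r * x \<in> I"
  by (simp add: is_ideal_def)

lemma is_ideal_uminus: "is_ideal I \<Longrightarrow> x \<in> I \<Longrightarrow> - x \<in> I"
  using is_ideal_mult[of I x "- 1"] by simp

lemma is_ideal_diff: "is_ideal I \<Longrightarrow> x \<in> I \<Longrightarrow> y \<in> I \<Longrightarrow> x - y \<in> I"
  using is_ideal_add[of I x "- y"] is_ideal_uminus[of I y] by simp

lemma coset_eq_iff:
  assumes "is_ideal I"
  shows "coset I x = coset I y \<longleftrightarrow> x - y \<in> I"
proof
  assume "coset I x = coset I y"
  moreover have "x \<in> coset I x"
    using assms by (simp add: coset_def is_ideal_zero)
  ultimately show "x - y \<in> I"
    by (simp add: coset_def)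
next
  assume xy: "x - y \<in> I"
  show "coset I x = coset I y"
  proof (rule Set.set_eqI)
    fix z
    show "z \<in> coset I x \<longleftrightarrow> z \<in> coset I y"
      using is_ideal_add[OF assms, of "z - x" "x - y"] is_ideal_diff[OF assms, of "z - y" "x - y"] xy
      by (auto simp: coset_def)
  qed
qed

lemma unit_ideal_eq_UNIV:
  fixes I :: "'a::comm_ring_1 set"
  assumes "is_ideal I" "u \<in> I" "u dvd 1"
  shows "I = UNIV"
proof -
  obtain v where "1 = u * v" using assms(3) by (elim dvdE)
  then have "x = (x * v) * u" for x
    by (metis mult.assoc mult.commute mult_1_right)
  then show ?thesis
    using is_ideal_mult[OF assms(1,2)] by (metis UNIV_eq_I)
qed

section \<open>Cyclicity of the unit group of the residue field\<close>

text \<open>The type-class ring as an explicit record, so that the theory of quotient rings and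
  finite fields applies to it.\<close>

definition whole_ring :: "'a::comm_ring_1 ring" where
  "whole_ring = \<lparr>carrier = UNIV, mult = (*), one = 1, zero = 0, add = (+)\<rparr>"

lemma cring_whole_ring: "cring whole_ring"
proof (rule cringI)
  show "abelian_group (whole_ring :: 'a ring)"
  proof (rule abelian_groupI)
    fix x :: 'a
    show "\<exists>y\<in>carrier whole_ring. y \<oplus>\<^bsub>whole_ring\<^esub> x = \<zero>\<^bsub>whole_ring\<^esub>"
      by (rule bexI[of _ "- x"]) (simp_all add: whole_ring_def)
  qed (simp_all add: whole_ring_def algebra_simps)
  show "comm_monoid (whole_ring :: 'a ring)"
    by (rule comm_monoidI) (simp_all add: whole_ring_def algebra_simps)
qed (simp add: whole_ring_def algebra_simps)

lemma ideal_whole_ring: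
  fixes I :: "'a::comm_ring_1 set"
  shows "ideal I whole_ring \<longleftrightarrow> is_ideal I"
proof
  assume "ideal I whole_ring"
  then interpret ideal I whole_ring .
  show "is_ideal I"
    unfolding is_ideal_def
    using additive_subgroup.a_closed[OF additive_subgroup_axioms] I_l_closed
      additive_subgroup.zero_closed[OF additive_subgroup_axioms]
    unfolding whole_ring_def by simp
next
  assume I: "is_ideal I"
  let ?R = "whole_ring :: 'a ring"
  interpret cring ?R by (rule cring_whole_ring)
  show "ideal I ?R"
  proof (rule idealI)
    show "subgroup I (add_monoid ?R)"
    proof (rule add.subgroupI)
      fix a assume "a \<in> I"
      moreover have "\<ominus>\<^bsub>?R\<^esub> a = - a"
        by (rule minus_equality) (simp_all add: whole_ring_def)
      ultimately show "\<ominus>\<^bsub>?R\<^esub> a \<in> I"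
        using I by (simp add: is_ideal_uminus)
    qed (use I in \<open>auto simp: is_ideal_def whole_ring_def\<close>)
    show "ring ?R" by (rule ring_axioms)
    fix a x assume a: "a \<in> I" "x \<in> carrier ?R"
    show "x \<otimes>\<^bsub>?R\<^esub> a \<in> I"
      using is_ideal_mult[OF I a(1), of x] by (simp add: whole_ring_def)
    then show "a \<otimes>\<^bsub>?R\<^esub> x \<in> I"
      using a by (simp add: whole_ring_def mult.commute)
  qed
qed

text \<open>The quotient by \<open>M\<close> is a finite field, whose unit group is cyclic;
  \<open>t\<close> lifts a generator.\<close>

lemma residue_units_cyclic:
  fixes M :: "'a::{comm_ring_1,finite} set"
  assumes M: "is_maximal_ideal M"
  shows "\<exists>t. t \<notin> M \<and> (\<forall>u. u \<notin> M \<longrightarrow> (\<exists>k. u - t ^ k \<in> M))"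
proof -
  let ?R = "whole_ring :: 'a ring"
  interpret cring ?R by (rule cring_whole_ring)
  have I: "is_ideal M" using M by (simp add: is_maximal_ideal_def)
  interpret maximalideal M ?R
  proof (rule maximalidealI)
    show "ideal M ?R" using I by (simp add: ideal_whole_ring)
    show "carrier ?R \<noteq> M" using M by (auto simp: is_maximal_ideal_def whole_ring_def)
    show "J = M \<or> J = carrier ?R" if "ideal J ?R" "M \<subseteq> J" for J
      using M that by (simp add: is_maximal_ideal_def ideal_whole_ring) (simp add: whole_ring_def)
  qed
  interpret Q: field "?R Quot M"
    by (rule quotient_is_field) (rule cring_whole_ring)
  define c where "c x = M +>\<^bsub>?R\<^esub> x" for x
  have carr: "carrier (?R Quot M) = range c"
    unfolding FactRing_def A_RCOSETS_defs a_r_coset_def c_def by (auto simp: whole_ring_def)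
  have c_alt: "c x = coset M x" for x
    by (force simp: c_def a_r_coset_def r_coset_def whole_ring_def coset_def algebra_simps)
  have c_eq: "c x = c y \<longleftrightarrow> x - y \<in> M" for x y
    by (simp add: c_alt coset_eq_iff[OF I])
  have c_mult: "c x \<otimes>\<^bsub>?R Quot M\<^esub> c y = c (x * y)" for x y
    using rcoset_mult_add[of x y] by (simp add: FactRing_def c_def whole_ring_def)
  have c_one: "\<one>\<^bsub>?R Quot M\<^esub> = c 1"
    by (simp add: FactRing_def c_def whole_ring_def)
  have c_zero: "\<zero>\<^bsub>?R Quot M\<^esub> = c 0"
    using c_alt by (simp add: FactRing_def coset_def)
  have c_pow: "c x [^]\<^bsub>?R Quot M\<^esub> (k::nat) = c (x ^ k)" for x k
    by (induction k) (simp_all add: c_one c_mult mult.commute)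
  have "finite (carrier (?R Quot M))" by (simp add: carr)
  then obtain g where "g \<in> carrier (mult_of (?R Quot M))"
    and "carrier (mult_of (?R Quot M)) = {g [^]\<^bsub>?R Quot M\<^esub> i | i::nat. i \<in> UNIV}"
    by (rule Q.finite_field_mult_group_has_gen[THEN bexE])
  then have g: "g \<in> range c - {c 0}"
    and gen: "range c - {c 0} = {g [^]\<^bsub>?R Quot M\<^esub> i | i::nat. i \<in> UNIV}"
    unfolding carrier_mult_of carr c_zero .
  obtain t where gt: "g = c t" using g by blast
  then have t: "c t \<noteq> c 0" using g by blast
  have "\<exists>k. u - t ^ k \<in> M" if "u \<notin> M" for u
  proof -
    have "c u \<in> range c - {c 0}" using that by (metis DiffI c_eq diff_zero rangeI singletonD)
    then obtain k :: nat where "c u = c t [^]\<^bsub>?R Quot M\<^esub> k"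
      unfolding gen gt by blast
    then show ?thesis by (auto simp: c_pow c_eq)
  qed
  then show ?thesis using t by (auto simp: c_eq)
qed

section \<open>Polynomial degree through finite differences\<close>

text \<open>\<open>diff_deg n f\<close> says that \<open>f\<close> behaves like a polynomial of degree less than \<open>n\<close>.\<close>

primrec diff_deg :: "nat \<Rightarrow> ('a::comm_ring_1 \<Rightarrow> 'a) \<Rightarrow> bool" where
  "diff_deg 0 f \<longleftrightarrow> (\<forall>x. f x = 0)"
| "diff_deg (Suc n) f \<longleftrightarrow> (\<forall>b. diff_deg n (\<lambda>x. f (x + b) - f x))"

lemma diff_deg_zero: "diff_deg n (\<lambda>x. 0)"
  by (induction n) simp_all

lemma diff_deg_Suc: "diff_deg n f \<Longrightarrow> diff_deg (Suc n) f"
proof (induction n arbitrary: f)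
  case (Suc n)
  then have "\<forall>b. diff_deg (Suc n) (\<lambda>x. f (x + b) - f x)"
    unfolding diff_deg.simps(2)[of n f] by (intro allI Suc.IH) blast
  then show ?case by (rule iffD2[OF diff_deg.simps(2)])
qed simp

lemma diff_deg_mono: "m \<le> n \<Longrightarrow> diff_deg m f \<Longrightarrow> diff_deg n f"
  by (induction n rule: dec_induct) (simp, rule diff_deg_Suc)

lemma diff_deg_add: "diff_deg n f \<Longrightarrow> diff_deg n g \<Longrightarrow> diff_deg n (\<lambda>x. f x + g x)"
proof (induction n arbitrary: f g)
  case (Suc n)
  have "diff_deg n (\<lambda>x. (f (x + b) - f x) + (g (x + b) - g x))" for b
    using Suc by simp
  then show ?case by (simp add: algebra_simps)
qed simp

lemma diff_deg_cmult: "diff_deg n f \<Longrightarrow> diff_deg n (\<lambda>x. a * f x)"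
proof (induction n arbitrary: f)
  case (Suc n)
  have "diff_deg n (\<lambda>x. a * (f (x + b) - f x))" for b
    using Suc by simp
  then show ?case by (simp add: algebra_simps)
qed simp

text \<open>A Leibniz rule: the difference of \<open>x * f x\<close> in direction \<open>b\<close>
  splits into \<open>x\<close> times the difference of \<open>f\<close>, \<open>b\<close> times that
  difference, and \<open>b * f x\<close>.\<close>

lemma diff_deg_mult_id: "diff_deg n f \<Longrightarrow> diff_deg (Suc n) (\<lambda>x. x * f x)"
proof (induction n arbitrary: f)
  case (Suc n)
  have "diff_deg (Suc n) (\<lambda>x. x * (f (x + b) - f x) + b * (f (x + b) - f x) + b * f x)" for b
  proof (intro diff_deg_add)
    have "diff_deg n (\<lambda>x. f (x + b) - f x)" using Suc.prems by simp
    then show "diff_deg (Suc n) (\<lambda>x. x * (f (x + b) - f x))"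
      "diff_deg (Suc n) (\<lambda>x. b * (f (x + b) - f x))"
      by (fact Suc.IH, intro diff_deg_Suc diff_deg_cmult)
    show "diff_deg (Suc n) (\<lambda>x. b * f x)" by (rule diff_deg_cmult) (rule Suc.prems)
  qed
  moreover have "(\<lambda>x. x * (f (x + b) - f x) + b * (f (x + b) - f x) + b * f x)
      = (\<lambda>x. (x + b) * f (x + b) - x * f x)" for b
    by (simp add: fun_eq_iff algebra_simps)
  ultimately have "diff_deg (Suc n) (\<lambda>x. (x + b) * f (x + b) - x * f x)" for b
    by metis
  then show ?case unfolding diff_deg.simps(2)[of "Suc n"] by blast
qed simp

lemma diff_deg_const: "diff_deg (Suc 0) (\<lambda>x. v)"
  by simp

lemma diff_deg_power: "diff_deg (Suc n) (\<lambda>x. v * (x - c) ^ n)"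
proof (induction n)
  case (Suc n)
  have "diff_deg (Suc (Suc n)) (\<lambda>x. x * (v * (x - c) ^ n) + (- c) * (v * (x - c) ^ n))"
    by (intro diff_deg_add diff_deg_mult_id diff_deg_Suc[of "Suc n"] diff_deg_cmult Suc)
  moreover have "(\<lambda>x. x * (v * (x - c) ^ n) + (- c) * (v * (x - c) ^ n)) = (\<lambda>x. v * (x - c) ^ Suc n)"
    by (simp add: fun_eq_iff algebra_simps)
  ultimately show ?case by metis
qed (simp add: diff_deg_const)

lemma diff_deg_sum:
  assumes "finite A" "\<And>c. c \<in> A \<Longrightarrow> diff_deg n (f c)"
  shows "diff_deg n (\<lambda>x. \<Sum>c\<in>A. f c x)"
  using assms by (induction A rule: finite_induct) (auto intro: diff_deg_add diff_deg_zero)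

section \<open>Principal and maximal ideals of a finite ring\<close>

lemma is_ideal_principal: "is_ideal (range ((*) (x::'a::comm_ring_1)))"
  unfolding is_ideal_def
proof (intro conjI allI ballI)
  show "0 \<in> range ((*) x)" by (rule range_eqI[of _ _ 0]) simp
  show "y + z \<in> range ((*) x)" if "y \<in> range ((*) x)" "z \<in> range ((*) x)" for y z
    using that by (auto simp: distrib_left[symmetric])
  show "r * y \<in> range ((*) x)" if y: "y \<in> range ((*) x)" for r y
  proof -
    obtain z where "y = x * z" using y by blast
    then show ?thesis by (intro range_eqI[of _ _ "r * z"]) (simp add: mult.left_commute)
  qed
qed

text \<open>Finiteness replaces Zorn: the proper ideals form a finite set.\<close>

lemma proper_ideal_in_maximal:
  fixes I :: "'a::{comm_ring_1,finite} set"
  assumes I: "is_ideal I" "I \<noteq> UNIV"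
  obtains M where "is_maximal_ideal M" "I \<subseteq> M"
proof -
  obtain M where M: "M \<in> {J. is_ideal J \<and> J \<noteq> UNIV}" "I \<subseteq> M"
    and max: "\<And>J. J \<in> {J. is_ideal J \<and> J \<noteq> UNIV} \<Longrightarrow> M \<subseteq> J \<Longrightarrow> M = J"
    using finite_has_maximal2[of "{J. is_ideal J \<and> J \<noteq> UNIV}" I] I by auto
  have "is_maximal_ideal M"
    using M max by (auto simp: is_maximal_ideal_def)
  then show thesis using M(2) by (rule that)
qed

lemma inj_mult_right_unit:
  assumes "(k::'a::comm_ring_1) * l = 1"
  shows "inj (\<lambda>x. x * k)"
proof (rule injI)
  fix x y assume "x * k = y * k"
  then have "x * (k * l) = y * (k * l)" by (simp only: mult.assoc[symmetric])
  then show "x = y" by (simp add: assms)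
qed

section \<open>The local ring, its radical and the ideal \<open>I0\<close>\<close>

locale pure_cyclotomic =
  fixes K :: "'a::{comm_ring_1, finite} set"
  assumes local: "local_ring TYPE('a)"
    and unit_subgroup: "unit_subgroup K"
    and pure: "pure_group K"
begin

lemma rad_maximal: "is_maximal_ideal (rad :: 'a set)"
  using local unfolding local_ring_def rad_def by (rule theI')

lemma rad_unique: "is_maximal_ideal (M :: 'a set) \<Longrightarrow> M = rad"
  using local rad_maximal unfolding local_ring_def by blast

lemma rad_ideal: "is_ideal (rad :: 'a set)"
  using rad_maximal by (simp add: is_maximal_ideal_def)

text \<open>A nonunit generates a proper ideal, which lies in the unique maximal one.\<close>

lemma rad_iff_nonunit: "(x::'a) \<in> rad \<longleftrightarrow> \<not> x dvd 1"
proof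
  assume "x \<in> rad"
  then show "\<not> x dvd 1"
    using unit_ideal_eq_UNIV[OF rad_ideal] rad_maximal by (auto simp: is_maximal_ideal_def)
next
  assume "\<not> x dvd 1"
  then have "range ((*) x) \<noteq> UNIV"
    by (metis UNIV_I dvd_def imageE)
  then obtain M where "is_maximal_ideal M" "range ((*) x) \<subseteq> M"
    using proper_ideal_in_maximal is_ideal_principal by blast
  then have "x * 1 \<in> rad" using rad_unique by blast
  then show "x \<in> rad" by simp
qed

lemma unit_add_rad:
  assumes "(u::'a) dvd 1" "x \<in> rad"
  shows "u + x dvd 1"
  using assms is_ideal_diff[OF rad_ideal, of "u + x" x] by (auto simp: rad_iff_nonunit)

lemma I0_subset_rad: "I0 \<subseteq> (rad :: 'a set)"
  by (auto simp: I0_def)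

lemma I0_mult_rad: "(x::'a) \<in> I0 \<Longrightarrow> y \<in> rad \<Longrightarrow> x * y = 0"
  by (simp add: I0_def)

lemma rad_mult_I0: "(x::'a) \<in> I0 \<Longrightarrow> y \<in> rad \<Longrightarrow> y * x = 0"
  using I0_mult_rad[of x y] by (simp add: mult.commute)

lemma I0_ideal: "is_ideal (I0 :: 'a set)"
  unfolding is_ideal_def I0_def
  using is_ideal_zero[OF rad_ideal] is_ideal_add[OF rad_ideal] is_ideal_mult[OF rad_ideal]
  by (simp add: distrib_right mult.assoc)

text \<open>Scalars act on \<open>I0\<close> only through their residues: \<open>I0\<close> is a
  vector space over the residue field.\<close>

lemma I0_mult_cong: "(x::'a) \<in> I0 \<Longrightarrow> r - s \<in> rad \<Longrightarrow> r * x = s * x"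
  using rad_mult_I0[of x "r - s"] by (simp add: left_diff_distrib)

section \<open>The group \<open>K\<close>, the additive group \<open>H\<close> and purity\<close>

lemma K_unit: "k \<in> K \<Longrightarrow> k dvd 1"
  using unit_subgroup by (simp add: unit_subgroup_def)

lemma K_one: "1 \<in> K"
  using unit_subgroup by (simp add: unit_subgroup_def)

lemma K_mult: "x \<in> K \<Longrightarrow> y \<in> K \<Longrightarrow> x * y \<in> K"
  using unit_subgroup by (simp add: unit_subgroup_def)

lemma K_inverse: "x \<in> K \<Longrightarrow> \<exists>y\<in>K. x * y = 1"
  using unit_subgroup by (simp add: unit_subgroup_def)

text \<open>Since products within \<open>I0\<close> vanish, adding 1 turns addition on
  \<open>H\<close> into multiplication in \<open>K\<close>; \<open>H\<close> is the additive form of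
  the subgroup of \<open>K\<close> congruent to 1 modulo \<open>I0\<close>.\<close>

definition H :: "'a set" where
  "H = {i \<in> I0. 1 + i \<in> K}"

lemma H_subset_I0: "H \<subseteq> I0"
  by (auto simp: H_def)

lemma H_zero: "0 \<in> H"
  using K_one is_ideal_zero[OF I0_ideal] by (simp add: H_def)

lemma I0_mult_I0: "(x::'a) \<in> I0 \<Longrightarrow> y \<in> I0 \<Longrightarrow> x * y = 0"
  using I0_mult_rad I0_subset_rad by blast

lemma H_add: "x \<in> H \<Longrightarrow> y \<in> H \<Longrightarrow> x + y \<in> H"
  using K_mult[of "1 + x" "1 + y"] I0_mult_I0[of x y] is_ideal_add[OF I0_ideal, of x y]
  by (simp add: H_def algebra_simps)

lemma H_uminus:
  assumes "x \<in> H"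
  shows "- x \<in> H"
proof -
  obtain y where y: "y \<in> K" "(1 + x) * y = 1"
    using assms K_inverse by (auto simp: H_def)
  have "(1 - x) * (1 + x) = 1"
    using assms I0_mult_I0[of x x] by (simp add: H_def algebra_simps)
  then have "y = 1 - x"
    using y(2) by (metis mult.assoc mult.commute mult_1_right)
  then show ?thesis
    using assms y(1) is_ideal_uminus[OF I0_ideal] by (simp add: H_def)
qed

lemma H_diff: "x \<in> H \<Longrightarrow> y \<in> H \<Longrightarrow> x - y \<in> H"
  using H_add[of x "- y"] H_uminus by simp

lemma pure_ideal_H: "is_ideal J \<Longrightarrow> J \<subseteq> H \<Longrightarrow> J = {0}"
  using pure by (auto simp: pure_group_def H_def)

text \<open>The principal ideal of \<open>w\<close> lies in \<open>H\<close>, hence is zero. Purity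
  is applied below in this form.\<close>

lemma pure_H:
  assumes "\<And>r. r * w \<in> H"
  shows "w = 0"
proof -
  have "range ((*) w) = {0}"
    using assms by (intro pure_ideal_H is_ideal_principal) (auto simp: mult.commute)
  then have "w * 1 = 0" by blast
  then show ?thesis by simp
qed

section \<open>Automorphisms of the cyclotomic scheme\<close>

lemma cyc_aut_diff:
  assumes "cyc_aut K f"
  obtains k where "k \<in> K" "f y - f x = (y - x) * k"
proof -
  have "y - x \<in> (\<lambda>k. (y - x) * k) ` K"
    using K_one by (intro image_eqI[of _ _ 1]) auto
  then have "f y - f x \<in> (\<lambda>k. (y - x) * k) ` K"
    using assms unfolding cyc_aut_def by blast
  then show thesis using that by blast
qed

text \<open>Differences only get multiplied by units from \<open>K\<close>, so \<open>f\<close>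
  respects congruence modulo every ideal, in particular modulo \<open>I0\<close>.\<close>

lemma cyc_aut_ideal_iff:
  assumes "cyc_aut K f" "is_ideal I"
  shows "f y - f x \<in> I \<longleftrightarrow> y - x \<in> I"
proof -
  obtain k where k: "k \<in> K" "f y - f x = (y - x) * k" by (rule cyc_aut_diff[OF assms(1)])
  obtain l where l: "k * l = 1" using K_inverse[OF k(1)] by blast
  have "y - x = l * (f y - f x)"
    using l by (metis k(2) mult.assoc mult.commute mult_1_right)
  then show ?thesis
    using is_ideal_mult[OF assms(2)] k(2) by (metis mult.commute)
qed

lemma cyc_autI:
  assumes "bij f"
    and "\<And>r x y. y - x \<in> (\<lambda>k. r * k) ` K \<longleftrightarrow> f y - f x \<in> (\<lambda>k. r * k) ` K"
  shows "cyc_aut K f"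
  using assms by (simp add: cyc_aut_def)

lemma cyc_aut_comp: "cyc_aut K f \<Longrightarrow> cyc_aut K g \<Longrightarrow> cyc_aut K (\<lambda>x. f (g x))"
  using bij_comp[of g f] by (simp add: cyc_aut_def o_def)

lemma cyc_aut_inverse:
  assumes "cyc_aut K f" "\<And>x. f (g x) = x"
  shows "cyc_aut K g"
proof (rule cyc_autI)
  have "inj g" by (rule injI) (metis assms(2))
  then show "bij g" by (simp add: bij_def finite_UNIV_inj_surj)
  show "y - x \<in> (\<lambda>k. r * k) ` K \<longleftrightarrow> g y - g x \<in> (\<lambda>k. r * k) ` K" for r x y
  proof -
    have "g y - g x \<in> (\<lambda>k. r * k) ` K \<longleftrightarrow> f (g y) - f (g x) \<in> (\<lambda>k. r * k) ` K"
      using assms(1) unfolding cyc_aut_def by blast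
    then show ?thesis by (simp add: assms(2))
  qed
qed

lemma cyc_aut_obtain_inverse:
  assumes "cyc_aut K f"
  obtains g where "cyc_aut K g" "\<And>x. f (g x) = x" "\<And>x. g (f x) = x"
proof -
  have f: "bij f" using assms by (simp add: cyc_aut_def)
  then obtain g where g: "\<And>x. f (g x) = x" by (metis bij_pointE)
  moreover have "g (f x) = x" for x using f g by (metis bij_pointE)
  ultimately show thesis using that cyc_aut_inverse[OF assms g] by blast
qed

lemma cyc_aut_translation: "cyc_aut K (\<lambda>x. x + b)"
  by (rule cyc_autI) (simp_all add: bij_plus_right)

lemma times_K_mem_iff:
  assumes "k \<in> K"
  shows "x * k \<in> (\<lambda>k. r * k) ` K \<longleftrightarrow> x \<in> (\<lambda>k. r * k) ` K"
proof
  obtain l where l: "l \<in> K" "k * l = 1" using K_inverse[OF assms] by blast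
  assume "x * k \<in> (\<lambda>k. r * k) ` K"
  then obtain m where "m \<in> K" "x * k = r * m" by blast
  then have "x = r * (m * l)" "m * l \<in> K"
    using l K_mult by (metis mult.assoc mult_1_right)+
  then show "x \<in> (\<lambda>k. r * k) ` K" by blast
next
  assume "x \<in> (\<lambda>k. r * k) ` K"
  then show "x * k \<in> (\<lambda>k. r * k) ` K"
    using K_mult[OF _ assms] by (auto simp: mult.assoc)
qed

lemma cyc_aut_times_K:
  assumes "k \<in> K"
  shows "cyc_aut K (\<lambda>x. x * k)"
proof (rule cyc_autI)
  obtain l where "k * l = 1" using K_inverse[OF assms] by blast
  then have "inj (\<lambda>x. x * k)" by (rule inj_mult_right_unit)
  then show "bij (\<lambda>x. x * k)" by (simp add: bij_def finite_UNIV_inj_surj)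
  show "y - x \<in> (\<lambda>k. r * k) ` K \<longleftrightarrow> y * k - x * k \<in> (\<lambda>k. r * k) ` K" for r x y
    using times_K_mem_iff[OF assms, of "y - x" r] by (simp add: left_diff_distrib)
qed

section \<open>Displacements of automorphisms trivial modulo \<open>I0\<close>\<close>

text \<open>Records what \<open>h x - x\<close> retains of such an automorphism \<open>h\<close>.
  The conditions pass to sums, differences, translates and rescalings, so that induction can stay
  inside the class.\<close>

definition disp :: "('a \<Rightarrow> 'a) \<Rightarrow> bool" where
  "disp d \<longleftrightarrow> (\<forall>x. d x \<in> I0) \<and> (\<forall>x y. x - y \<in> rad \<longrightarrow> d x = d y) \<and>
     (\<forall>x y. (x - y) dvd 1 \<longrightarrow> (\<exists>i\<in>H. d x - d y = (x - y) * i))"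

text \<open>A unit difference is multiplied by some \<open>k \<in> K\<close>; dividing by it shows
  \<open>k - 1 \<in> I0\<close>, so \<open>k - 1 \<in> H\<close>. Constancy on cosets of
  \<open>rad\<close> then comes from purity.\<close>

lemma disp_of_cyc_aut:
  assumes h: "cyc_aut K h" and triv: "\<And>x. h x - x \<in> I0"
  shows "disp (\<lambda>x. h x - x)"
proof -
  define d where "d x = h x - x" for x
  have d_I0: "d x \<in> I0" for x using triv by (simp add: d_def)
  have unit: "\<exists>i\<in>H. d x - d y = (x - y) * i" if u: "(x - y) dvd 1" for x y
  proof -
    obtain k where k: "k \<in> K" "h x - h y = (x - y) * k" by (rule cyc_aut_diff[OF h])
    obtain v where v: "v * (x - y) = 1" using u by (metis dvdE mult.commute)
    have eq: "d x - d y = (x - y) * (k - 1)"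
      using k(2) by (simp add: d_def algebra_simps)
    then have "k - 1 = v * (d x - d y)"
      by (metis v mult.assoc mult_1_left)
    then have "k - 1 \<in> I0"
      using d_I0 is_ideal_diff is_ideal_mult I0_ideal by metis
    then have "k - 1 \<in> H" using k(1) by (simp add: H_def)
    with eq show ?thesis by blast
  qed
  have "d x = d y" if xy: "x - y \<in> rad" for x y
  proof -
    have "r * (d x - d y) \<in> H" for r
    proof (cases "r dvd 1")
      case True
      \<comment> \<open>The detour through \<open>x - v\<close> works because this point differs
        from both \<open>x\<close> and \<open>y\<close> by a unit, congruent to \<open>v\<close> and
        \<open>- v\<close> respectively.\<close>
      then obtain v where v: "r * v = 1" by (metis dvdE)
      have v1: "v dvd 1" using v by (metis dvd_triv_right)
      have "- v + (x - y) dvd 1"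
        using v1 xy by (intro unit_add_rad) simp_all
      then obtain j where j: "j \<in> H" "d (x - v) - d y = (x - v - y) * j"
        using unit[of "x - v" y] by (auto simp: algebra_simps)
      obtain i where i: "i \<in> H" "d x - d (x - v) = v * i"
        using unit[of x "x - v"] v1 by auto
      have "(x - v - y) * j = - v * j"
        using j(1) H_subset_I0 xy by (intro I0_mult_cong) auto
      then have "d x - d y = v * (i - j)"
        using i(2) j(2) by (simp add: algebra_simps)
      then have "r * (d x - d y) = i - j"
        using v by (metis mult.assoc mult_1_left)
      then show ?thesis using i j H_diff by simp
    next
      case False
      then have "r * (d x - d y) = 0"
        using d_I0 is_ideal_diff[OF I0_ideal] by (simp add: rad_mult_I0 rad_iff_nonunit)
      then show ?thesis by (simp add: H_zero)
    qed
    then have "d x - d y = 0" by (rule pure_H)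
    then show ?thesis by simp
  qed
  with d_I0 unit show ?thesis by (simp add: disp_def d_def[symmetric])
qed

lemma disp_diff:
  assumes "disp d" "disp e"
  shows "disp (\<lambda>x. d x - e x)"
  unfolding disp_def
proof (intro conjI allI impI)
  show "d x - e x \<in> I0" for x
    using assms is_ideal_diff[OF I0_ideal] by (simp add: disp_def)
  show "d x - e x = d y - e y" if "x - y \<in> rad" for x y
    using assms that by (metis disp_def)
  show "\<exists>i\<in>H. d x - e x - (d y - e y) = (x - y) * i" if u: "(x - y) dvd 1" for x y
  proof -
    obtain i j where "i \<in> H" "d x - d y = (x - y) * i" "j \<in> H" "e x - e y = (x - y) * j"
      using assms u by (metis disp_def)
    then have "i - j \<in> H" "d x - e x - (d y - e y) = (x - y) * (i - j)"
      using H_diff by (auto simp: algebra_simps)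
    then show ?thesis by blast
  qed
qed

lemma disp_translate: "disp d \<Longrightarrow> disp (\<lambda>x. d (x + b))"
  unfolding disp_def by (metis add_diff_cancel_right)

lemma disp_zero: "disp (\<lambda>x. 0)"
  using H_zero is_ideal_zero[OF I0_ideal] unfolding disp_def by (auto intro: bexI[of _ 0])

lemma disp_add: "disp d \<Longrightarrow> disp e \<Longrightarrow> disp (\<lambda>x. d x + e x)"
  using disp_diff[of d "\<lambda>x. 0 - e x"] disp_diff[of "\<lambda>x. 0" e] disp_zero by simp

lemma disp_const: "c \<in> I0 \<Longrightarrow> disp (\<lambda>x. c)"
  using H_zero unfolding disp_def by (auto intro: bexI[of _ 0])

lemma disp_scale:
  assumes "disp d" and tt: "t * t' = 1"
  shows "disp (\<lambda>x. t' * d (t * x))"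
  unfolding disp_def
proof (intro conjI allI impI)
  show "t' * d (t * x) \<in> I0" for x
    using assms is_ideal_mult[OF I0_ideal] by (simp add: disp_def)
  show "t' * d (t * x) = t' * d (t * y)" if "x - y \<in> rad" for x y
    using assms(1) is_ideal_mult[OF rad_ideal that, of t]
    by (metis disp_def right_diff_distrib)
  show "\<exists>i\<in>H. t' * d (t * x) - t' * d (t * y) = (x - y) * i" if u: "(x - y) dvd 1" for x y
  proof -
    have "t dvd 1" using tt by (metis dvd_triv_left)
    then have "t * x - t * y dvd 1"
      using u mult_dvd_mono[of t 1 "x - y" 1] by (simp add: right_diff_distrib)
    then obtain i where i: "i \<in> H" "d (t * x) - d (t * y) = (t * x - t * y) * i"
      using assms(1) by (metis disp_def)
    have "t' * d (t * x) - t' * d (t * y) = (t * t') * ((x - y) * i)"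
      using i(2) by (simp add: algebra_simps) (metis distrib_left mult.left_commute)
    then show ?thesis using i(1) tt by auto
  qed
qed

section \<open>Linearity of additive displacements\<close>

text \<open>Let T rescale by \<open>t\<close>, sending \<open>d\<close> to
  \<open>\<lambda>x. t' * d (t * x)\<close>. The image \<open>W\<close> of 1 - T turns out to be
  stable under scalars, so purity makes it zero and \<open>d\<close> commutes with \<open>t\<close>.
  Up to \<open>rad\<close>, every unit is a power of \<open>t\<close>.\<close>

lemma disp_additive_linear:
  assumes d: "disp d" and d_add: "\<And>x y. d (x + y) = d x + d y"
  shows "d x = x * d 1"
proof -
  obtain t where t: "t \<notin> (rad :: 'a set)" and gen: "\<And>u. u \<notin> (rad :: 'a set) \<Longrightarrow> \<exists>k. u - t ^ k \<in> rad"
    using residue_units_cyclic[OF rad_maximal] by blast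
  obtain t' where t': "t * t' = 1"
    using t by (metis rad_iff_nonunit dvdE)
  have tp: "t ^ k * t' ^ k = 1" for k
    using t' by (metis power_mult_distrib power_one)
  define ad where "ad d \<longleftrightarrow> disp d \<and> (\<forall>x y. d (x + y) = d x + d y)" for d
  define W where "W = {(\<lambda>x. d x - t' * d (t * x)) | d. ad d}"
  have W_I: "(\<lambda>x. d x - t' * d (t * x)) \<in> W" if "ad d" for d
    using that by (auto simp: W_def)
  have ad_scale: "ad (\<lambda>x. s' * d (s * x))" if "ad d" "s * s' = 1" for d s s'
    using that disp_scale by (simp add: ad_def distrib_left)
  have ad_diff: "ad (\<lambda>x. d x - e x)" if "ad d" "ad e" for d e
    using that disp_diff by (simp add: ad_def)
  have ad_add: "ad (\<lambda>x. d x + e x)" if "ad d" "ad e" for d e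
    using that disp_add by (simp add: ad_def algebra_simps)
  have W_ad: "ad w" if "w \<in> W" for w
    using that t' ad_diff ad_scale by (auto simp: W_def)
  have W_diff: "(\<lambda>x. v x - w x) \<in> W" if vw: "v \<in> W" "w \<in> W" for v w
  proof -
    obtain d e where "ad d" "v = (\<lambda>x. d x - t' * d (t * x))" "ad e" "w = (\<lambda>x. e x - t' * e (t * x))"
      using vw unfolding W_def by blast
    then show ?thesis
      using W_I[OF ad_diff[of d e]] by (simp add: algebra_simps)
  qed
  have ad_zero: "ad (\<lambda>x. 0)" by (simp add: ad_def disp_zero)
  have W_zero: "(\<lambda>x. 0) \<in> W" using W_I[OF ad_zero] by simp
  have W_add: "(\<lambda>x. v x + w x) \<in> W" if "v \<in> W" "w \<in> W" for v w
    using W_diff[OF that(1) W_diff[OF W_zero that(2)]] by simp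
  \<comment> \<open>Telescoping: 1 - T^(k+1) = (1 - T) + (1 - T^k) T.\<close>
  have W_pow: "(\<lambda>x. d x - t' ^ k * d (t ^ k * x)) \<in> W" if "ad d" for d k
    using that
  proof (induction k arbitrary: d)
    case (Suc k)
    have "(\<lambda>x. (d x - t' * d (t * x)) + (t' * d (t * x) - t' ^ k * (t' * d (t * (t ^ k * x))))) \<in> W"
      using W_add[OF W_I[OF Suc.prems] Suc.IH[OF ad_scale[OF Suc.prems t']]] .
    then show ?case by (simp add: mult.assoc mult.left_commute)
  qed (simp add: W_zero)
  \<comment> \<open>If \<open>1 + t\<close> is in \<open>rad\<close>, then \<open>t\<close> acts on
    \<open>I0\<close> as \<open>- 1\<close>. Otherwise \<open>1 + t\<close> is a power of
    \<open>t\<close> modulo \<open>rad\<close>, and division by \<open>1 + t\<close> is shown to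
    permute \<open>W\<close>.\<close>
  have W_t: "(\<lambda>x. t * w x) \<in> W" if w: "w \<in> W" for w
  proof (cases "1 + t \<in> rad")
    case True
    have "t * w x = 0 - w x" for x
      using W_ad[OF w] True I0_mult_cong[of "w x" t "- 1"] by (simp add: ad_def disp_def add.commute)
    then show ?thesis using W_diff[OF W_zero w] by simp
  next
    case False
    obtain v where v: "(1 + t) * v = 1"
      using False by (metis rad_iff_nonunit dvdE)
    obtain k where k: "1 + t - t ^ k \<in> rad" using gen[OF False] by blast
    define \<phi> where "\<phi> w = (\<lambda>x::'a. v * w x)" for w
    have \<phi>_W: "\<phi> w \<in> W" if w: "w \<in> W" for w
    proof -
      obtain d where d: "ad d" "w = (\<lambda>x. d x - t' * d (t * x))"
        using w by (auto simp: W_def)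
      \<comment> \<open>The identity T^k - T = v (1 - T): \<open>t ^ k\<close> is replaced by
        \<open>1 + t\<close>, where additivity of \<open>d\<close> applies, and \<open>t'\<close> by
        \<open>v + v * t'\<close>.\<close>
      have "(d x - t' * d (t * x)) - (d x - t' ^ k * d (t ^ k * x)) = v * w x" for x
      proof -
        have "(1 + t) * x - t ^ k * x \<in> rad"
          using is_ideal_mult[OF rad_ideal k, of x] by (simp add: algebra_simps)
        then have e1: "d (t ^ k * x) = d ((1 + t) * x)"
          using d(1) by (metis ad_def disp_def)
        have e2: "t' ^ k * d ((1 + t) * x) = v * d ((1 + t) * x)"
        proof (rule I0_mult_cong)
          show "d ((1 + t) * x) \<in> I0" using d(1) by (simp add: ad_def disp_def)
          have "t' ^ k - v = t' ^ k * ((1 + t) * v) - v * (t ^ k * t' ^ k)"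
            by (simp add: v tp)
          also have "\<dots> = (t' ^ k * v) * (1 + t - t ^ k)"
            by (simp add: algebra_simps)
          finally show "t' ^ k - v \<in> rad" using is_ideal_mult[OF rad_ideal k] by simp
        qed
        have e3: "d ((1 + t) * x) = d x + d (t * x)"
          using d(1) by (simp add: ad_def distrib_right)
        have "t' = v + v * t'"
        proof -
          have "t' = t' * ((1 + t) * v)" by (simp add: v)
          also have "\<dots> = (t * t') * v + v * t'" by (simp add: algebra_simps)
          finally show ?thesis by (simp add: t')
        qed
        then have e4: "t' * d (t * x) = v * d (t * x) + v * (t' * d (t * x))"
          by (metis distrib_right mult.assoc)
        have "(d x - t' * d (t * x)) - (d x - t' ^ k * d (t ^ k * x))
            = t' ^ k * d ((1 + t) * x) - t' * d (t * x)"
          by (simp add: e1)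
        also have "\<dots> = v * (d x + d (t * x)) - (v * d (t * x) + v * (t' * d (t * x)))"
          by (subst e2, subst e3, subst e4) (rule refl)
        also have "\<dots> = v * w x"
          by (simp add: d(2) algebra_simps)
        finally show ?thesis .
      qed
      then show ?thesis
        using W_diff[OF W_I[OF d(1)] W_pow[OF d(1), of k]] by (simp add: \<phi>_def)
    qed
    \<comment> \<open>An injective self-map of the finite set \<open>W\<close> is onto, so
      \<open>W\<close> is closed under multiplication by \<open>1 + t\<close>; subtracting
      \<open>w\<close> leaves the multiple by \<open>t\<close>.\<close>
    have "inj_on \<phi> W"
    proof (rule inj_onI)
      fix w1 w2 assume "\<phi> w1 = \<phi> w2"
      then have "(1 + t) * v * w1 x = (1 + t) * v * w2 x" for x
        by (metis \<phi>_def mult.assoc)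
      then show "w1 = w2" by (simp add: v fun_eq_iff)
    qed
    then have "\<phi> ` W = W"
      using \<phi>_W by (intro endo_inj_surj) auto
    then obtain w' where w': "w' \<in> W" "w = \<phi> w'" using w by blast
    have "t * w x = w' x - w x" for x
    proof -
      have "(1 + t) * w x = (1 + t) * v * w' x" by (simp add: w'(2) \<phi>_def mult.assoc)
      then have "(1 + t) * w x = w' x" by (simp only: v mult_1_left)
      then show ?thesis by (simp add: algebra_simps)
    qed
    then show ?thesis using W_diff[OF w'(1) w] by simp
  qed
  have W_tpow: "(\<lambda>x. t ^ k * w x) \<in> W" if "w \<in> W" for w k
    using that by (induction k) (simp_all add: W_t mult.assoc)
  have W_one: "w 1 = 0" if w: "w \<in> W" for w
  proof (rule pure_H)
    fix r
    have I0: "w x \<in> I0" for x using W_ad[OF w] by (simp add: ad_def disp_def)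
    have "(\<lambda>x. r * w x) \<in> W"
    proof (cases "r \<in> rad")
      case True
      then show ?thesis using rad_mult_I0[OF I0] W_zero by simp
    next
      case False
      then obtain k where "r - t ^ k \<in> rad" using gen by blast
      then have "r * w x = t ^ k * w x" for x by (rule I0_mult_cong[OF I0])
      then show ?thesis using W_tpow[OF w] by simp
    qed
    then have rw: "ad (\<lambda>x. r * w x)" by (rule W_ad)
    \<comment> \<open>Additivity gives the value 0 at 0; the unit difference of the points 1 and 0
      then puts \<open>r * w 1\<close> into \<open>H\<close>.\<close>
    then have "r * w 0 = 0" unfolding ad_def by (metis add_cancel_right_right)
    then show "r * w 1 \<in> H"
      using rw unfolding ad_def disp_def by (metis diff_zero dvd_refl mult_1_left)
  qed
  have W_trivial: "w x = 0" if w: "w \<in> W" for w x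
  proof (cases "x \<in> rad")
    case True
    then have "w x = w 0" using W_ad[OF w] by (simp add: ad_def disp_def)
    also have "\<dots> = 0" using W_ad[OF w] unfolding ad_def by (metis add_cancel_right_right)
    finally show ?thesis .
  next
    case False
    then obtain k where "x - t ^ k \<in> rad" using gen by blast
    then have "w x = w (t ^ k)" using W_ad[OF w] by (simp add: ad_def disp_def)
    \<comment> \<open>Subtracting (1 - T^k) w from \<open>w\<close> shows that T^k w is in
      \<open>W\<close>; its value at 1 is \<open>t' ^ k * w (t ^ k)\<close>.\<close>
    moreover have "(\<lambda>x. w x - (w x - t' ^ k * w (t ^ k * x))) \<in> W"
      using W_diff[OF w W_pow[OF W_ad[OF w]]] .
    then have "t' ^ k * w (t ^ k) = 0" using W_one by fastforce
    then have "w (t ^ k) = 0" using tp[of k] by (metis mult.assoc mult_1_left mult_zero_right)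
    ultimately show ?thesis by simp
  qed
  have ad: "ad d" using d d_add by (simp add: ad_def)
  have "d x = t' * d (t * x)" for x
    using W_trivial[OF W_I[OF ad], of x] by simp
  then have d_t: "d (t * x) = t * d x" for x
    using t' by (metis mult.assoc mult_1_left)
  have d_tpow: "d (t ^ k) = t ^ k * d 1" for k
    by (induction k) (simp_all add: d_t mult.assoc)
  have I0: "d 1 \<in> I0" using d by (simp add: disp_def)
  show ?thesis
  proof (cases "x \<in> rad")
    case True
    then have "d x = d 0" using d by (simp add: disp_def)
    also have "\<dots> = 0" using d_add by (metis add_cancel_right_right)
    finally show ?thesis using rad_mult_I0[OF I0 True] by simp
  next
    case False
    then obtain k where k: "x - t ^ k \<in> rad" using gen by blast
    then have "d x = d (t ^ k)" using d by (simp add: disp_def)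
    then show ?thesis using I0_mult_cong[OF I0 k] d_tpow by simp
  qed
qed

section \<open>Displacements as polynomial and affine functions\<close>

text \<open>Lagrange interpolation over the residue field: if \<open>t ^ n = 1\<close> with
  \<open>n > 0\<close>, then on \<open>I0\<close> the scalar \<open>1 - (x - c) ^ n\<close> acts as
  the indicator of \<open>x - c \<in> rad\<close>. Summing over representatives \<open>c\<close> of
  the cosets of \<open>rad\<close> recovers \<open>d\<close>.\<close>

lemma disp_diff_deg:
  assumes d: "disp d"
  obtains n where "diff_deg n d"
proof -
  obtain t where t: "t \<notin> (rad :: 'a set)" and gen: "\<And>u. u \<notin> (rad :: 'a set) \<Longrightarrow> \<exists>k. u - t ^ k \<in> rad"
    using residue_units_cyclic[OF rad_maximal] by blast
  obtain t' where t': "t * t' = 1"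
    using t by (metis rad_iff_nonunit dvdE)
  have tp: "t ^ k * t' ^ k = 1" for k
    using t' by (metis power_mult_distrib power_one)
  have "\<not> inj (\<lambda>k::nat. t ^ k)"
    using finite_imageD[of "\<lambda>k::nat. t ^ k" UNIV] by auto
  then obtain i j :: nat where "i < j" "t ^ i = t ^ j"
    by (metis injI linorder_neqE_nat)
  then obtain n where n: "t ^ n = 1" "n > 0"
  proof -
    have "t ^ (j - i) = (t ^ i * t' ^ i) * t ^ (j - i)" by (simp add: tp)
    also have "\<dots> = (t ^ i * t ^ (j - i)) * t' ^ i" by (simp only: ac_simps)
    also have "\<dots> = t ^ i * t' ^ i"
      by (metis \<open>i < j\<close> \<open>t ^ i = t ^ j\<close> le_add_diff_inverse less_imp_le power_add)
    also have "\<dots> = 1" by (rule tp)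
    finally show thesis using that[of "j - i"] \<open>i < j\<close> by simp
  qed
  have delta: "v * (1 - u ^ n) = (if u \<in> rad then v else 0)" if v: "v \<in> I0" for v u :: 'a
  proof (cases "u \<in> rad")
    case True
    then have "u ^ n \<in> rad"
      using n(2) is_ideal_mult[OF rad_ideal True, of "u ^ (n - 1)"] by (metis power_minus_mult)
    then show ?thesis using True I0_mult_rad[OF v] by (simp add: right_diff_distrib)
  next
    case False
    then obtain k where k: "u - t ^ k \<in> rad" using gen by blast
    have "u ^ m - t ^ (k * m) \<in> rad" for m
    proof (induction m)
      case (Suc m)
      have "u ^ Suc m - t ^ (k * Suc m) = u * (u ^ m - t ^ (k * m)) + t ^ (k * m) * (u - t ^ k)"
        by (simp add: algebra_simps power_add)
      then show ?case
        using is_ideal_add[OF rad_ideal] is_ideal_mult[OF rad_ideal] Suc k by simp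
    qed (simp add: is_ideal_zero[OF rad_ideal])
    moreover have "t ^ (k * n) = 1" using n(1) by (metis mult.commute power_mult power_one)
    ultimately have "u ^ n - 1 \<in> rad" by metis
    then have "1 - u ^ n \<in> rad" using is_ideal_uminus[OF rad_ideal] by fastforce
    then show ?thesis using False I0_mult_rad[OF v] by simp
  qed
  define \<rho> where "\<rho> x = (SOME y. y - x \<in> (rad :: 'a set))" for x
  have \<rho>: "\<rho> x - x \<in> rad" for x
    unfolding \<rho>_def by (rule someI[of _ x]) (simp add: is_ideal_zero[OF rad_ideal])
  have \<rho>_eq: "x - \<rho> y \<in> rad \<longleftrightarrow> \<rho> y = \<rho> x" for x y
  proof
    assume xy: "x - \<rho> y \<in> rad"
    \<comment> \<open>Congruent elements yield equal predicates under \<open>SOME\<close>, hence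
      literally the same representative.\<close>
    have "(\<lambda>z. z - y \<in> rad) = (\<lambda>z. z - x \<in> rad)"
    proof (rule ext)
      fix z
      have e: "x - y \<in> rad" using is_ideal_add[OF rad_ideal xy \<rho>[of y]] by simp
      show "z - y \<in> rad \<longleftrightarrow> z - x \<in> rad"
        using is_ideal_add[OF rad_ideal _ e, of "z - x"] is_ideal_diff[OF rad_ideal _ e, of "z - y"]
        by auto
    qed
    then show "\<rho> y = \<rho> x" by (simp add: \<rho>_def)
  next
    assume "\<rho> y = \<rho> x"
    then show "x - \<rho> y \<in> rad" using is_ideal_uminus[OF rad_ideal \<rho>[of x]] by simp
  qed
  have "d x = (\<Sum>c\<in>range \<rho>. d c + (- d c) * (x - c) ^ n)" for x
  proof -
    have "d c + (- d c) * (x - c) ^ n = (if c = \<rho> x then d c else 0)" if c: "c \<in> range \<rho>" for c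
    proof -
      have "d c \<in> I0" using d by (simp add: disp_def)
      then have "d c * (1 - (x - c) ^ n) = (if x - c \<in> rad then d c else 0)" by (rule delta)
      moreover have "x - c \<in> rad \<longleftrightarrow> c = \<rho> x" using c \<rho>_eq by auto
      ultimately show ?thesis by (simp add: algebra_simps)
    qed
    then have "(\<Sum>c\<in>range \<rho>. d c + (- d c) * (x - c) ^ n) = (\<Sum>c\<in>range \<rho>. if c = \<rho> x then d c else 0)"
      by (rule sum.cong[OF refl])
    also have "\<dots> = d (\<rho> x)" by simp
    also have "\<dots> = d x" using d \<rho> by (simp add: disp_def)
    finally show ?thesis by simp
  qed
  then have "d = (\<lambda>x. \<Sum>c\<in>range \<rho>. d c + (- d c) * (x - c) ^ n)" by (rule ext)
  moreover have "diff_deg (Suc n) (\<lambda>x. \<Sum>c\<in>range \<rho>. d c + (- d c) * (x - c) ^ n)"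
    by (intro diff_deg_sum diff_deg_add diff_deg_power diff_deg_mono[OF _ diff_deg_const]) simp_all
  ultimately have "diff_deg (Suc n) d" by simp
  then show thesis by (rule that)
qed

lemma disp_unit_shift:
  assumes "disp d"
  shows "d (x + 1) - d x \<in> H"
proof -
  have "(x + 1) - x dvd 1" by simp
  then obtain i where "i \<in> H" "d (x + 1) - d x = ((x + 1) - x) * i"
    using assms unfolding disp_def by blast
  then show ?thesis by simp
qed

text \<open>Induction on the degree: the difference in direction \<open>b\<close> is a displacement
  of lower degree, hence affine with a slope \<open>\<alpha> b\<close>. Symmetry and purity force
  \<open>\<alpha> = 0\<close>, so \<open>d x - d 0\<close> is additive, hence linear.\<close>

lemma disp_affine:
  assumes "disp d"
  shows "d x = d 0 + x * (d 1 - d 0)"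
proof -
  obtain n where "diff_deg n d" using assms by (rule disp_diff_deg)
  then have "\<forall>x. d x = d 0 + x * (d 1 - d 0)" using assms
  proof (induction n arbitrary: d)
    case (Suc n)
    define \<alpha> where "\<alpha> b = (d (1 + b) - d 1) - (d b - d 0)" for b
    have shift: "disp (\<lambda>x. d (x + b) - d x)" for b
      using Suc.prems(2) by (intro disp_diff disp_translate)
    have \<alpha>: "d (x + b) - d x = d b - d 0 + x * \<alpha> b" for x b
    proof -
      have "diff_deg n (\<lambda>x. d (x + b) - d x)" using Suc.prems(1) by (simp only: diff_deg.simps)
      from Suc.IH[OF this shift, THEN spec, of x] show ?thesis by (simp add: \<alpha>_def)
    qed
    \<comment> \<open>Both sides are the mixed second difference of \<open>d\<close> at 0 in the
      directions \<open>x\<close> and \<open>b\<close>.\<close>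
    have "x * \<alpha> b = b * \<alpha> x" for x b
    proof -
      have "x * \<alpha> b = d (x + b) - d x - (d b - d 0)"
        unfolding \<alpha> by simp
      also have "\<dots> = d (b + x) - d b - (d x - d 0)" by (simp only: add.commute[of x b]) simp
      also have "\<dots> = b * \<alpha> x" unfolding \<alpha> by simp
      finally show ?thesis .
    qed
    then have \<alpha>_lin: "b * \<alpha> 1 = \<alpha> b" for b by (metis mult_1_left)
    have "\<alpha> b \<in> H" for b
      using disp_unit_shift[OF shift[of b], of 0] by (simp add: \<alpha>_def)
    then have "b * \<alpha> 1 \<in> H" for b by (simp only: \<alpha>_lin)
    then have "\<alpha> 1 = 0" by (rule pure_H)
    then have d_add: "d (x + b) - d 0 = (d x - d 0) + (d b - d 0)" for x b
    proof -
      have "\<alpha> b = 0" using \<alpha>_lin[of b] \<open>\<alpha> 1 = 0\<close> by simp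
      then show ?thesis using \<alpha>[of x b] by (simp add: algebra_simps)
    qed
    have "disp (\<lambda>x. d x - d 0)"
      using Suc.prems(2) by (intro disp_diff disp_const) (simp_all add: disp_def)
    then have "d x - d 0 = x * (d 1 - d 0)" for x
      by (rule disp_additive_linear) (rule d_add)
    then show ?case by (simp add: algebra_simps)
  qed simp
  then show ?thesis by blast
qed

section \<open>Rigidity modulo \<open>I0\<close> and lifting to affine semilinear maps\<close>

text \<open>The displacement is affine and vanishes at 0, so it is multiplication by its value at 1,
  which the unit step from 0 to 1 places in \<open>H\<close>.\<close>

lemma cyc_aut_trivial_mod_I0:
  assumes h: "cyc_aut K h" and triv: "\<And>x. h x - x \<in> I0" and h0: "h 0 = 0"
  obtains a where "a \<in> H" "\<And>x. h x = x + a * x"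
proof
  have disp: "disp (\<lambda>x. h x - x)" using h triv by (rule disp_of_cyc_aut)
  show "h 1 - 1 \<in> H" using disp_unit_shift[OF disp, of 0] h0 by simp
  show "h x = x + (h 1 - 1) * x" for x
    using disp_affine[OF disp, of x] h0 by (simp add: algebra_simps)
qed

lemma coset_I0_eq_iff: "coset I0 (x::'a) = coset I0 y \<longleftrightarrow> x - y \<in> I0"
  by (rule coset_eq_iff[OF I0_ideal])

lemma cyc_aut_multiple:
  assumes "cyc_aut K f" "f 0 = 0"
  obtains k where "k \<in> K" "f x = x * k"
  using cyc_aut_diff[OF assms(1), of x 0] assms(2) by auto

text \<open>With \<open>g\<close> inverse to \<open>f\<close>, sending \<open>x\<close> to
  \<open>g (f (x + z) - f z)\<close> is trivial modulo \<open>I0\<close> and fixes 0, hence is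
  multiplication by \<open>1 + a z\<close>. Exchanging \<open>x\<close> and \<open>z\<close> makes
  \<open>a\<close> linear with values in \<open>H\<close>, so purity kills it.\<close>

lemma normalized_additive:
  assumes f: "cyc_aut K f" and f0: "f 0 = 0"
    and f_add: "\<And>x y. f (x + y) - (f x + f y) \<in> I0"
  shows "f (x + y) = f x + f y"
proof -
  obtain g where g: "cyc_aut K g" "\<And>x. f (g x) = x" "\<And>x. g (f x) = x"
    using cyc_aut_obtain_inverse[OF f] by blast
  have "\<exists>a\<in>H. \<forall>x. f (x + z) - f z = f (x + a * x)" for z
  proof -
    have "cyc_aut K (\<lambda>x. g (f (x + z) + - f z))"
      by (intro cyc_aut_comp[OF g(1)] cyc_aut_comp[OF cyc_aut_translation]
          cyc_aut_comp[OF f] cyc_aut_translation)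
    moreover have "g (f (x + z) + - f z) - x \<in> I0" for x
    proof -
      have "f (g (f (x + z) + - f z)) - f x \<in> I0"
        using f_add[of x z] by (simp add: g(2) algebra_simps)
      then show ?thesis by (simp add: cyc_aut_ideal_iff[OF f I0_ideal])
    qed
    moreover have "g (f (0 + z) + - f z) = 0" using g(3)[of 0] f0 by simp
    ultimately obtain a where "a \<in> H" "\<And>x. g (f (x + z) + - f z) = x + a * x"
      using cyc_aut_trivial_mod_I0[of "\<lambda>x. g (f (x + z) + - f z)"] by blast
    moreover from this(2) have "f (x + z) - f z = f (x + a * x)" for x
      using g(2)[of "f (x + z) + - f z"] by simp
    ultimately show ?thesis by blast
  qed
  then obtain a where aH: "\<And>z. a z \<in> H"
    and a: "\<And>z x. f (x + z) - f z = f (x + a z * x)" by metis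
  have a_I0: "a z \<in> I0" for z using aH H_subset_I0 by blast
  \<comment> \<open>For an argument in \<open>I0\<close> the correction is a product of two elements
    of \<open>I0\<close>, so additivity is exact and the error term below can be split off.\<close>
  have f_I0: "f (i + z) = f i + f z" if "i \<in> I0" for i z
    using a[of i z] I0_mult_I0[OF a_I0 that] by (simp add: algebra_simps)
  have a_mult: "f (x + z) = f x + f z + f (a z * x)" for x z
    using a[of x z] f_I0[of "a z * x" x] is_ideal_mult[OF I0_ideal a_I0, of x z]
    by (simp add: algebra_simps)
  have "f (a z * x) = f (a x * z)" for x z
    using a_mult[of x z] a_mult[of z x] by (simp add: algebra_simps)
  then have "g (f (a z * x)) = g (f (a x * z))" for x z by (rule arg_cong)
  then have "a z * x = a x * z" for x z by (simp only: g(3))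
  from this[where x = 1] have a1: "a z = z * a 1" for z by (metis mult.commute mult_1_right)
  then have "z * a 1 \<in> H" for z using aH by metis
  then have "a 1 = 0" by (rule pure_H)
  then show ?thesis using a_mult[of x y] a1[of y] f0 by simp
qed

text \<open>For a unit \<open>z\<close>, multiplying by \<open>z\<close>, applying \<open>f\<close>,
  dividing by \<open>f z\<close> and applying the inverse of \<open>f\<close> is trivial modulo
  \<open>I0\<close>. It is therefore multiplication by some \<open>1 + a\<close>, and fixing 1
  forces \<open>a = 0\<close>.\<close>

lemma normalized_multiplicative:
  assumes f: "cyc_aut K f" and f0: "f 0 = 0" and f1: "f 1 = 1"
    and f_add: "\<And>x y. f (x + y) = f x + f y"
    and f_mult: "\<And>x y. f (x * y) - f x * f y \<in> I0"
  shows "f (z * x) = f z * f x"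
proof -
  obtain g where g: "cyc_aut K g" "\<And>x. f (g x) = x" "\<And>x. g (f x) = x"
    using cyc_aut_obtain_inverse[OF f] by blast
  have unit: "f (z * x) = f z * f x" if "z dvd 1" for z x
  proof -
    obtain z' where z': "z * z' = 1" using \<open>z dvd 1\<close> by (metis dvdE)
    obtain k where k: "k \<in> K" "f z = z * k" using cyc_aut_multiple[OF f f0] by blast
    obtain l where l: "l \<in> K" "k * l = 1" using K_inverse[OF k(1)] by blast
    have inv: "(z' * l) * f z = 1"
    proof -
      have "(z' * l) * f z = (z * z') * (k * l)" by (simp add: k(2) ac_simps)
      then show ?thesis by (simp add: z' l(2))
    qed
    \<comment> \<open>The inverse of \<open>f z\<close> is \<open>z' * l\<close>. The factor
      \<open>l \<in> K\<close> already gives an automorphism; multiplying by \<open>z\<close> takes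
      the relation of \<open>r\<close> to that of \<open>z * r\<close>, and \<open>z'\<close> takes
      it back.\<close>
    define e where "e x = f (z * x) * z'" for x
    have "cyc_aut K e"
    proof (rule cyc_autI)
      have "inj f" using f by (simp add: cyc_aut_def bij_def)
      moreover have "inj (\<lambda>x. x * z)" "inj (\<lambda>x. x * z')"
        using inj_mult_right_unit[OF z'] inj_mult_right_unit[of z' z] z' by (simp_all add: mult.commute)
      ultimately have "inj e"
        unfolding e_def inj_def by (metis mult.commute)
      then show "bij e" by (simp add: bij_def finite_UNIV_inj_surj)
      have cancel: "z * u \<in> (\<lambda>k. (z * r) * k) ` K \<longleftrightarrow> u \<in> (\<lambda>k. r * k) ` K" for u r
      proof
        assume "z * u \<in> (\<lambda>k. (z * r) * k) ` K"
        then obtain m where m: "m \<in> K" "z * u = z * (r * m)" by (auto simp: mult.assoc)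
        then have "u = r * m" using z' by (metis mult.assoc mult.commute mult_1_left)
        then show "u \<in> (\<lambda>k. r * k) ` K" using m(1) by blast
      qed (auto simp: mult.assoc)
      show "y - x \<in> (\<lambda>k. r * k) ` K \<longleftrightarrow> e y - e x \<in> (\<lambda>k. r * k) ` K" for r x y
      proof -
        have "y - x \<in> (\<lambda>k. r * k) ` K \<longleftrightarrow> z * y - z * x \<in> (\<lambda>k. (z * r) * k) ` K"
          by (simp add: cancel right_diff_distrib[symmetric])
        also have "\<dots> \<longleftrightarrow> f (z * y) - f (z * x) \<in> (\<lambda>k. (z * r) * k) ` K"
          using f by (simp add: cyc_aut_def)
        also have "f (z * y) - f (z * x) = z * (e y - e x)"
        proof -
          have "z * (e y - e x) = (z * z') * (f (z * y) - f (z * x))"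
            by (simp add: e_def algebra_simps)
          then show ?thesis by (simp add: z')
        qed
        finally show ?thesis by (simp add: cancel)
      qed
    qed
    then have "cyc_aut K (\<lambda>x. g (e x * l))"
      by (intro cyc_aut_comp[OF g(1)] cyc_aut_comp[OF cyc_aut_times_K[OF l(1)]])
    moreover have "g (e x * l) - x \<in> I0" for x
    proof -
      have "e x * l - f x = (z' * l) * (f (z * x) - f z * f x)"
      proof -
        have "(z' * l) * (f (z * x) - f z * f x) = e x * l - ((z' * l) * f z) * f x"
          by (simp add: e_def algebra_simps)
        then show ?thesis by (simp add: inv)
      qed
      then have "f (g (e x * l)) - f x \<in> I0"
        using is_ideal_mult[OF I0_ideal f_mult] by (simp add: g(2))
      then show ?thesis by (simp add: cyc_aut_ideal_iff[OF f I0_ideal])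
    qed
    moreover have "g (e 0 * l) = 0" using g(3)[of 0] f0 by (simp add: e_def)
    ultimately obtain a where a: "\<And>x. g (e x * l) = x + a * x"
      using cyc_aut_trivial_mod_I0[of "\<lambda>x. g (e x * l)"] by blast
    have "e 1 * l = 1" using inv by (simp add: e_def ac_simps)
    then have "a = 0" using a[of 1] g(3)[of 1] f1 by simp
    then have "e x * l = f x" using a[of x] g(2)[of "e x * l"] by simp
    then have "f z * f x = f z * (e x * l)" by simp
    also have "\<dots> = (z' * l * f z) * f (z * x)" by (simp add: e_def ac_simps)
    finally have "f z * f x = (z' * l * f z) * f (z * x)" .
    then show ?thesis by (simp add: inv)
  qed
  show ?thesis
  proof (cases "z dvd 1")
    case False
    \<comment> \<open>A nonunit \<open>z\<close> is reached from the unit \<open>1 + z\<close> by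
      additivity.\<close>
    then have "1 + z dvd 1" using unit_add_rad[of 1 z] by (simp add: rad_iff_nonunit)
    then have "f ((1 + z) * x) = f (1 + z) * f x" by (rule unit)
    then show ?thesis by (simp add: distrib_right f_add f1)
  qed (rule unit)
qed

text \<open>Normalise \<open>f\<close> to \<open>e\<close>, which fixes 0 and 1. The constants of
  the induced affine map then become trivial, so \<open>e\<close> is additive and multiplicative
  modulo \<open>I0\<close>, and both properties lift to exact ones.\<close>

lemma AGaL1_lift:
  assumes hyp: "\<And>f. cyc_aut K f \<Longrightarrow> \<exists>t. (\<forall>x. t (coset I0 x) = coset I0 (f x)) \<and> q_AGaL1 I0 t"
    and f: "cyc_aut K f"
  shows "AGaL1 f"
proof -
  obtain k where k: "k \<in> K" "f 1 - f 0 = (1 - 0) * k" by (rule cyc_aut_diff[OF f])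
  obtain l where l: "l \<in> K" "k * l = 1" using K_inverse[OF k(1)] by blast
  define e where "e x = (f x + - f 0) * l" for x
  have e: "cyc_aut K e"
    unfolding e_def
    by (intro cyc_aut_comp[OF cyc_aut_times_K[OF l(1)]] cyc_aut_comp[OF cyc_aut_translation] f)
  have e0: "e 0 = 0" by (simp add: e_def)
  have e1: "e 1 = 1" using k(2) l(2) by (simp add: e_def)
  obtain t where t: "\<And>x. t (coset I0 x) = coset I0 (e x)" "q_AGaL1 I0 t"
    using hyp[OF e] by blast
  obtain a b s where s: "q_ring_aut I0 s"
    and ts: "\<And>x u. s (coset I0 x) = coset I0 u \<Longrightarrow> t (coset I0 x) = coset I0 (a * u + b)"
    using t(2) unfolding q_AGaL1_def by blast
  have s_add: "s (coset I0 (x + y)) = coset I0 (u + v)" and s_mult: "s (coset I0 (x * y)) = coset I0 (u * v)"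
    if "s (coset I0 x) = coset I0 u" "s (coset I0 y) = coset I0 v" for x y u v
    using s that by (auto simp: q_ring_aut_def)
  have s_ex: "\<exists>u. s (coset I0 x) = coset I0 u" for x
    using s unfolding q_ring_aut_def cosets_def by (blast dest: bij_betw_apply)
  have eu: "e x - (a * u + b) \<in> I0" if "s (coset I0 x) = coset I0 u" for x u
    using ts[OF that] by (simp add: t(1) coset_I0_eq_iff)
  \<comment> \<open>Being additive, \<open>s\<close> fixes the zero coset, and so does the map
    induced by \<open>e\<close>.\<close>
  have b: "b \<in> I0"
  proof -
    obtain u where u: "s (coset I0 0) = coset I0 u" using s_ex by blast
    then have "coset I0 (u + u) = coset I0 u" using s_add[OF u u] by simp
    then have "u \<in> I0" by (simp add: coset_I0_eq_iff)
    moreover have "- (a * u + b) \<in> I0" using eu[OF u] e0 by simp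
    ultimately have "- (- (a * u + b)) - a * u \<in> I0"
      using is_ideal_diff[OF I0_ideal] is_ideal_uminus[OF I0_ideal] is_ideal_mult[OF I0_ideal] by blast
    then show ?thesis by simp
  qed
  have a: "1 - a \<in> I0"
  proof -
    have "s (coset I0 1) = coset I0 1" using s by (simp add: q_ring_aut_def)
    from eu[OF this] have "1 - (a + b) \<in> I0" using e1 by simp
    from is_ideal_add[OF I0_ideal this b] show ?thesis by simp
  qed
  have se: "s (coset I0 x) = coset I0 (e x)" for x
  proof -
    obtain u where u: "s (coset I0 x) = coset I0 u" using s_ex by blast
    have "u - e x = u * (1 - a) - (e x - (a * u + b)) - b" by (simp add: algebra_simps)
    also have "\<dots> \<in> I0"
      by (intro is_ideal_diff[OF I0_ideal] is_ideal_mult[OF I0_ideal] a b eu[OF u])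
    finally show ?thesis by (simp add: u coset_I0_eq_iff)
  qed
  have "e (x + y) - (e x + e y) \<in> I0" for x y
    using s_add[OF se se, of x y] by (simp add: se coset_I0_eq_iff)
  then have e_add: "e (x + y) = e x + e y" for x y
    by (rule normalized_additive[OF e e0])
  have "e (x * y) - e x * e y \<in> I0" for x y
    using s_mult[OF se se, of x y] by (simp add: se coset_I0_eq_iff)
  then have e_mult: "e (x * y) = e x * e y" for x y
    by (rule normalized_multiplicative[OF e e0 e1 e_add])
  have "ring_aut e"
    using e e_add e_mult e1 by (simp add: ring_aut_def cyc_aut_def)
  moreover have "f x = k * e x + f 0" for x
  proof -
    have "k * e x = (k * l) * (f x - f 0)" by (simp add: e_def ac_simps)
    then show ?thesis by (simp add: l(2))
  qed
  ultimately show ?thesis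
    unfolding AGaL1_def using K_unit[OF k(1)] by blast
qed

section \<open>The natural mapping to the quotient scheme and its injectivity\<close>

text \<open>Direct image under \<open>s\<close> serves as \<open>t\<close>: since \<open>s\<close>
  is onto and respects congruence modulo \<open>I0\<close> in both directions, it maps cosets onto
  whole cosets.\<close>

lemma induced_quotient_aut:
  assumes s: "cyc_aut K s" "ring_aut s"
  shows "\<exists>t. q_cyc_aut I0 K t \<and> q_ring_aut I0 t \<and> (\<forall>x. t (coset I0 x) = coset I0 (s x))"
proof -
  have I0_iff: "s x - s y \<in> I0 \<longleftrightarrow> x - y \<in> I0" for x y
    by (rule cyc_aut_ideal_iff[OF s(1) I0_ideal])
  have surj: "surj s" using s(1) by (simp add: cyc_aut_def bij_def)
  have img: "s ` coset I0 x = coset I0 (s x)" for x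
  proof -
    have "y \<in> s ` coset I0 x" if "y - s x \<in> I0" for y
      using that surj I0_iff by (metis coset_def imageI mem_Collect_eq surjD)
    then show ?thesis using I0_iff by (auto simp: coset_def)
  qed
  have eq: "coset I0 (s x) = coset I0 u \<longleftrightarrow> s x - u \<in> I0" for x u
    by (rule coset_I0_eq_iff)
  have s_add: "s (x + y) = s x + s y" and s_mult: "s (x * y) = s x * s y" for x y
    using s(2) by (auto simp: ring_aut_def)
  have bij: "bij_betw ((`) s) (cosets I0) (cosets I0)"
    unfolding bij_betw_def
  proof
    show "inj_on ((`) s) (cosets I0)"
      using s(1) by (auto simp: inj_on_def cyc_aut_def bij_def inj_image_eq_iff)
    have "((`) s) ` cosets I0 = coset I0 ` range s"
      by (simp add: cosets_def image_image img)
    then show "((`) s) ` cosets I0 = cosets I0"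
      by (simp add: surj cosets_def)
  qed
  have "q_ring_aut I0 ((`) s)"
    unfolding q_ring_aut_def
  proof (intro conjI allI impI bij)
    fix x y u v
    assume "s ` coset I0 x = coset I0 u \<and> s ` coset I0 y = coset I0 v"
    then have xu: "s x - u \<in> I0" and yv: "s y - v \<in> I0"
      by (simp_all add: img coset_I0_eq_iff)
    have sum: "s (x + y) - (u + v) = (s x - u) + (s y - v)" by (simp add: s_add)
    show "s ` coset I0 (x + y) = coset I0 (u + v)"
      unfolding img coset_I0_eq_iff sum by (rule is_ideal_add[OF I0_ideal xu yv])
    have prod: "s (x * y) - u * v = s x * (s y - v) + v * (s x - u)" by (simp add: s_mult algebra_simps)
    show "s ` coset I0 (x * y) = coset I0 (u * v)"
      unfolding img coset_I0_eq_iff prod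
      by (intro is_ideal_add[OF I0_ideal] is_ideal_mult[OF I0_ideal] xu yv)
  next
    show "s ` coset I0 1 = coset I0 1" using s(2) by (simp add: img ring_aut_def)
  qed
  moreover have "q_cyc_aut I0 K ((`) s)"
    unfolding q_cyc_aut_def
  proof (intro conjI allI impI bij)
    fix r x y u v
    assume "s ` coset I0 x = coset I0 u \<and> s ` coset I0 y = coset I0 v"
    then have xu: "s x - u \<in> I0" and yv: "s y - v \<in> I0"
      by (simp_all add: img coset_I0_eq_iff)
    \<comment> \<open>The multiples of \<open>r\<close> by \<open>K\<close> are the points related
      to 0, which \<open>s\<close> fixes, so \<open>s\<close> permutes them and witnesses pull back
      along \<open>s\<close>.\<close>
    have rel: "(\<exists>k\<in>K. w - r * k \<in> I0) \<longleftrightarrow> (\<exists>k\<in>K. s w - r * k \<in> I0)" for w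
    proof -
      have rK: "m - 0 \<in> (\<lambda>k. r * k) ` K \<longleftrightarrow> s m - s 0 \<in> (\<lambda>k. r * k) ` K" for m
        using s(1) unfolding cyc_aut_def by blast
      have s0: "s 0 = 0" using s_add[of 0 0] by simp
      have "(\<exists>k\<in>K. s w - r * k \<in> I0) \<longleftrightarrow> (\<exists>m. s m \<in> (\<lambda>k. r * k) ` K \<and> s w - s m \<in> I0)"
        using surj by (auto simp: image_iff) (metis surjD)
      also have "\<dots> \<longleftrightarrow> (\<exists>m. m \<in> (\<lambda>k. r * k) ` K \<and> w - m \<in> I0)"
        using rK s0 by (simp add: I0_iff)
      also have "\<dots> \<longleftrightarrow> (\<exists>k\<in>K. w - r * k \<in> I0)" by blast
      finally show ?thesis by simp
    qed
    have d: "s (y - x) - (v - u) \<in> I0"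
    proof -
      have "s (y - x) = s y - s x" using s_add[of "y - x" x] by simp
      then have "s (y - x) - (v - u) = (s y - v) - (s x - u)" by simp
      then show ?thesis using is_ideal_diff[OF I0_ideal yv xu] by (simp only:)
    qed
    have shift: "s (y - x) - m \<in> I0 \<longleftrightarrow> v - u - m \<in> I0" for m
      using d by (metis coset_I0_eq_iff)
    show "(\<exists>k\<in>K. coset I0 (y - x) = coset I0 (r * k)) \<longleftrightarrow>
        (\<exists>k\<in>K. coset I0 (v - u) = coset I0 (r * k))"
      using rel[of "y - x"] by (simp add: coset_I0_eq_iff shift)
  qed
  ultimately show ?thesis using img by blast
qed

text \<open>The inverse of \<open>s1\<close> after \<open>s2\<close> is trivial modulo
  \<open>I0\<close> and fixes 0, hence is multiplication by some \<open>1 + a\<close>; it also fixes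
  1, so \<open>a = 0\<close>.\<close>

lemma induced_quotient_aut_inj:
  assumes s1: "cyc_aut K s1" "ring_aut s1" and s2: "cyc_aut K s2" "ring_aut s2"
    and eq: "\<And>x. coset I0 (s1 x) = coset I0 (s2 x)"
  shows "s1 = s2"
proof -
  obtain g where g: "cyc_aut K g" "\<And>x. s1 (g x) = x" "\<And>x. g (s1 x) = x"
    using cyc_aut_obtain_inverse[OF s1(1)] by blast
  have zero: "s1 0 = 0" "s2 0 = 0"
    using s1(2) s2(2) by (metis add_cancel_right_right ring_aut_def)+
  have one: "s1 1 = 1" "s2 1 = 1"
    using s1(2) s2(2) by (simp_all add: ring_aut_def)
  have "cyc_aut K (\<lambda>x. g (s2 x))" by (rule cyc_aut_comp[OF g(1) s2(1)])
  moreover have "g (s2 x) - x \<in> I0" for x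
  proof -
    have "s1 (g (s2 x)) - s1 x \<in> I0"
      using eq[of x, symmetric] by (simp add: g(2) coset_I0_eq_iff)
    then show ?thesis by (simp add: cyc_aut_ideal_iff[OF s1(1) I0_ideal])
  qed
  moreover have "g (s2 0) = 0" using g(3)[of 0] zero by simp
  ultimately obtain a where a: "\<And>x. g (s2 x) = x + a * x"
    using cyc_aut_trivial_mod_I0[of "\<lambda>x. g (s2 x)"] by blast
  have "a = 0" using a[of 1] g(3)[of 1] one by simp
  then have "s2 x = s1 x" for x using a[of x] g(2)[of "s2 x"] by simp
  then show ?thesis by (simp add: fun_eq_iff)
qed

end

theorem theorem6p1:
  fixes K :: "'a::{comm_ring_1, finite} set"
  assumes "local_ring TYPE('a)"
    and "unit_subgroup K"
    and "pure_group K"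
  shows "(\<forall>s. cyc_aut K s \<and> ring_aut s \<longrightarrow>
            (\<exists>t. q_cyc_aut I0 K t \<and> q_ring_aut I0 t \<and> (\<forall>x. t (coset I0 x) = coset I0 (s x))))
       \<and> (\<forall>s1 s2. cyc_aut K s1 \<and> ring_aut s1 \<and> cyc_aut K s2 \<and> ring_aut s2 \<and>
            (\<forall>x. coset I0 (s1 x) = coset I0 (s2 x)) \<longrightarrow> s1 = s2)
       \<and> ((\<forall>f. cyc_aut K f \<longrightarrow> (\<exists>t. (\<forall>x. t (coset I0 x) = coset I0 (f x)) \<and> q_AGaL1 I0 t))
            \<longrightarrow> (\<forall>f. cyc_aut K f \<longrightarrow> AGaL1 f))"
proof -
  interpret pure_cyclotomic K
    using assms by (rule pure_cyclotomic.intro)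
  show ?thesis
  proof (intro conjI allI impI)
    fix s assume "cyc_aut K s \<and> ring_aut s"
    then show "\<exists>t. q_cyc_aut I0 K t \<and> q_ring_aut I0 t \<and> (\<forall>x. t (coset I0 x) = coset I0 (s x))"
      by (elim conjE) (rule induced_quotient_aut)
  next
    fix s1 s2
    assume "cyc_aut K s1 \<and> ring_aut s1 \<and> cyc_aut K s2 \<and> ring_aut s2 \<and>
      (\<forall>x. coset I0 (s1 x) = coset I0 (s2 x))"
    then show "s1 = s2"
      by (elim conjE) (rule induced_quotient_aut_inj, assumption+, erule spec)
  next
    fix f
    assume hyp: "\<forall>f. cyc_aut K f \<longrightarrow>
        (\<exists>t. (\<forall>x. t (coset I0 x) = coset I0 (f x)) \<and> q_AGaL1 I0 t)"
      and f: "cyc_aut K f"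
    from hyp[rule_format] f show "AGaL1 f"
      by (rule AGaL1_lift)
  qed
qed

end
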